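(* Let $p$ and $q$ be odd primes such that $p=\frac{q^k-1}{q-1}$ for some positive integer $k$. Then there exists a transitive imprimitive permutation group of degree $pq$ admitting a system of imprimitivity with blocks of size $q$ whose intersection density equals $q$.
   Context: For a permutation group $G$ on a set $V$, two elements $g,h\in G$ are intersecting if $g(v)=h(v)$ for some $v\in V$; a subset $\mathcal{F}\subseteq G$ is intersecting if every pair of its elements is intersecting. The intersection density of $G$ is $\rho(G)=\max\{|\mathcal{F}|:\mathcal{F}\subseteq G \text{ intersecting}\}/\max_{v\in V}|G_v|$, where $G_v$ is the stabilizer of $v$. *)

theory Defs
  imports Complex_Main "HOL-Combinatorics.Permutations" "HOL-Computational_Algebra.Primes"
begin

definition perm_group :: "'a set \<Rightarrow> ('a \<Rightarrow> 'a) set \<Rightarrow> bool" where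
  "perm_group V G \<longleftrightarrow> (\<forall>g\<in>G. g permutes V) \<and> id \<in> G \<and>
     (\<forall>g\<in>G. \<forall>h\<in>G. g \<circ> h \<in> G) \<and> (\<forall>g\<in>G. inv g \<in> G)"

definition transitive_group :: "'a set \<Rightarrow> ('a \<Rightarrow> 'a) set \<Rightarrow> bool" where
  "transitive_group V G \<longleftrightarrow> (\<forall>u\<in>V. \<forall>v\<in>V. \<exists>g\<in>G. g u = v)"

definition block_system :: "'a set \<Rightarrow> ('a \<Rightarrow> 'a) set \<Rightarrow> 'a set set \<Rightarrow> bool" where
  "block_system V G \<B> \<longleftrightarrow>
     (\<forall>B\<in>\<B>. B \<noteq> {}) \<and> \<Union>\<B> = V \<and>
     (\<forall>B\<in>\<B>. \<forall>C\<in>\<B>. B \<noteq> C \<longrightarrow> B \<inter> C = {}) \<and>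
     (\<forall>g\<in>G. \<forall>B\<in>\<B>. g ` B \<in> \<B>)"

definition imprimitive_group :: "'a set \<Rightarrow> ('a \<Rightarrow> 'a) set \<Rightarrow> bool" where
  "imprimitive_group V G \<longleftrightarrow>
     (\<exists>\<B>. block_system V G \<B> \<and> (\<exists>B\<in>\<B>. 1 < card B \<and> B \<noteq> V))"

definition intersecting_pair :: "'a set \<Rightarrow> ('a \<Rightarrow> 'a) \<Rightarrow> ('a \<Rightarrow> 'a) \<Rightarrow> bool" where
  "intersecting_pair V g h \<longleftrightarrow> (\<exists>v\<in>V. g v = h v)"

definition intersecting_set :: "'a set \<Rightarrow> ('a \<Rightarrow> 'a) set \<Rightarrow> bool" where
  "intersecting_set V F \<longleftrightarrow> (\<forall>g\<in>F. \<forall>h\<in>F. intersecting_pair V g h)"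

definition stabilizer :: "('a \<Rightarrow> 'a) set \<Rightarrow> 'a \<Rightarrow> ('a \<Rightarrow> 'a) set" where
  "stabilizer G v = {g \<in> G. g v = v}"

definition intersection_density :: "'a set \<Rightarrow> ('a \<Rightarrow> 'a) set \<Rightarrow> real" where
  "intersection_density V G =
     real (Max {card F | F. F \<subseteq> G \<and> intersecting_set V F}) /
     real (Max {card (stabilizer G v) | v. v \<in> V})"

end

(* Points are pairs (i, x) with i in Z/p and x in F_q. A cyclic code C of length p over F_q acts by
   (i, x) -> (i, x + c i), and together with the shift of i it generates a group of order p |C|, whose
   point stabilizers have order |C| / q. The words form an intersecting set as soon as every word has a
   zero. No intersecting set is larger, because two elements with the same word differ by a shift,
   which has no fixed points.

   Such a code consists of the words c_v i = (A^i v) 0 for v in F_q^k, where A is in GL(k, q) and has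
   order p. Since p is prime and does not divide q - 1, A permutes the p points of the projective space
   cyclically, so the orbit of every vector meets the hyperplane of vectors with zeroth coordinate 0.
   The order of GL(k, q) is a multiple of q^k - 1 by transitivity on nonzero vectors, so A exists. *)

theory Submission
  imports Defs "HOL-Number_Theory.Residues" "HOL-Algebra.Sylow"
begin

section \<open>The permutation group of a cyclic code\<close>

text \<open>Words are indexed by all naturals with period \<open>p\<close>, so that the cyclic shift
  is plain \<open>Suc\<close>. Closure under addition already gives closure under scalars, which are
  repeated sums. \<open>has_zero\<close> will make words intersect; \<open>nontrivial\<close> will
  give transitivity inside the fibres.\<close>

locale cyclic_code =
  fixes p q :: nat and C :: "(nat \<Rightarrow> nat) set"
  assumes p_gt_1: "1 < p" and prime_q: "prime q"
    and periodic: "c \<in> C \<Longrightarrow> c (i + p) = c i"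
    and bounded: "c \<in> C \<Longrightarrow> c i < q"
    and add_closed: "c \<in> C \<Longrightarrow> d \<in> C \<Longrightarrow> (\<lambda>i. (c i + d i) mod q) \<in> C"
    and shift_closed: "c \<in> C \<Longrightarrow> (\<lambda>i. c (Suc i)) \<in> C"
    and has_zero: "c \<in> C \<Longrightarrow> \<exists>i. c i = 0"
    and nontrivial: "\<exists>c\<in>C. \<exists>i. c i \<noteq> 0"
begin

section \<open>The code as a linear space over F_q\<close>

lemma q_gt_1: "1 < q"
  using prime_q prime_gt_1_nat by blast

lemma periodic_mult:
  assumes "c \<in> C" shows "c (i + n * p) = c i"
proof (induction n)
  case (Suc n)
  have "c (i + Suc n * p) = c ((i + n * p) + p)" by (simp add: algebra_simps)
  then show ?case using periodic[OF assms] Suc by simp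
qed simp

lemma periodic_mod:
  assumes "c \<in> C" shows "c (i mod p) = c i"
  using periodic_mult[OF assms, of "i mod p" "i div p"] by simp

lemma shift_by_closed:
  assumes "c \<in> C" shows "(\<lambda>i. c (i + s)) \<in> C"
proof (induction s)
  case (Suc s)
  then show ?case using shift_closed by fastforce
qed (simp add: assms)

lemma smult_closed:
  assumes "c \<in> C" shows "(\<lambda>i. (a * c i) mod q) \<in> C"
proof -
  have pos: "(\<lambda>i. (Suc a * c i) mod q) \<in> C" for a
  proof (induction a)
    case 0
    then show ?case using assms bounded[OF assms] by simp
  next
    case (Suc a)
    then show ?case
      using add_closed[OF assms Suc] by (simp add: mod_add_right_eq add_ac)
  qed
  show ?thesis
  proof (cases a)
    case 0
    \<comment> \<open>Factor 0 is congruent to factor \<open>Suc (q - 1)\<close>, which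
      \<open>pos\<close> covers.\<close>
    then show ?thesis using pos[of "q - 1"] q_gt_1 by simp
  qed (use pos in simp)
qed

text \<open>A nonzero entry can be shifted to position \<open>j\<close> and, being a unit modulo
  \<open>q\<close>, scaled to any value.\<close>

lemma word_with_value:
  assumes "a < q"
  obtains c where "c \<in> C" "c j = a"
proof -
  obtain c i where c: "c \<in> C" "c i \<noteq> 0" using nontrivial by blast
  \<comment> \<open>The summand \<open>(p - 1) * j\<close> stands for \<open>-j\<close>: position
    \<open>j\<close> of \<open>d\<close> reads \<open>c (i + j * p)\<close>, which is
    \<open>c i\<close>.\<close>
  define d where "d = (\<lambda>n. c (n + (i + (p - 1) * j)))"
  have "j + (i + (p - 1) * j) = i + j * p"
    using p_gt_1 by (cases p) (auto simp: algebra_simps)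
  then have dj: "d j = c i" unfolding d_def using periodic_mult[OF c(1)] by metis
  have d: "d \<in> C" unfolding d_def by (rule shift_by_closed[OF c(1)])
  have "\<not> q dvd d j" using c(2) bounded[OF c(1), of i] dj by (auto dest: dvd_imp_le)
  then have "coprime (d j) q" using prime_q by (simp add: coprime_commute prime_imp_coprime)
  then obtain b where "[d j * b = 1] (mod q)"
    using cong_solve_coprime_nat by (metis One_nat_def)
  then have "[a * b * d j = a] (mod q)"
    using cong_scalar_left[of "d j * b" 1 q a] by (simp add: ac_simps)
  then have "(a * b * d j) mod q = a" using assms by (simp add: cong_def)
  then show thesis using that[OF smult_closed[OF d, of "a * b"]] by simp
qed

lemma words_eqI:
  assumes "c \<in> C" "d \<in> C" "\<And>i. i < p \<Longrightarrow> c i = d i"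
  shows "c = d"
proof
  fix i
  show "c i = d i"
    using assms(3)[of "i mod p"] p_gt_1 periodic_mod[OF assms(1)] periodic_mod[OF assms(2)] by simp
qed

lemma finite_C: "finite C"
proof (rule inj_on_finite)
  show "inj_on (\<lambda>c. restrict c {..<p}) C"
    by (intro inj_onI words_eqI) (auto, metis lessThan_iff restrict_apply')
  show "(\<lambda>c. restrict c {..<p}) ` C \<subseteq> {..<p} \<rightarrow>\<^sub>E {..<q}"
    using bounded by (auto simp: PiE_iff split: if_splits)
qed (simp add: finite_PiE)

lemma C_pos: "0 < card C"
  using finite_C nontrivial card_gt_0_iff by blast

text \<open>Evaluation at \<open>i\<close> is linear onto F_q, and the vanishing words are its
  kernel. A word \<open>d\<close> with \<open>d i = 1\<close> spans a complement.\<close>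

lemma card_vanishing: "q * card {c \<in> C. c i = 0} = card C"
proof -
  obtain d where d: "d \<in> C" "d i = 1" using word_with_value q_gt_1 by blast
  let ?f = "\<lambda>(c, a) j. (c j + (a * d j) mod q) mod q"
  have "bij_betw ?f ({c \<in> C. c i = 0} \<times> {..<q}) C"
  proof (rule bij_betw_imageI)
    show "inj_on ?f ({c \<in> C. c i = 0} \<times> {..<q})"
    proof (rule inj_onI)
      fix y z
      assume yz: "y \<in> {c \<in> C. c i = 0} \<times> {..<q}" "z \<in> {c \<in> C. c i = 0} \<times> {..<q}" "?f y = ?f z"
      obtain c a c' a' where [simp]: "y = (c, a)" "z = (c', a')" by fastforce
      have c: "c \<in> C" "c i = 0" "c' \<in> C" "c' i = 0" and a: "a \<in> {..<q}" "a' \<in> {..<q}"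
        and eq: "?f (c, a) = ?f (c', a')"
        using yz by simp_all
      have [simp]: "a = a'" using fun_cong[OF eq, of i] c a d(2) by simp
      have "c j = c' j" for j
      proof -
        have "[c j + (a' * d j) mod q = c' j + (a' * d j) mod q] (mod q)"
          using fun_cong[OF eq, of j] by (simp add: cong_def)
        then have "[c j = c' j] (mod q)" by (simp only: cong_add_rcancel_nat)
        then show ?thesis using bounded c by (simp add: cong_def)
      qed
      then show "y = z" by auto
    qed
    show "?f ` ({c \<in> C. c i = 0} \<times> {..<q}) = C"
    proof
      show "?f ` ({c \<in> C. c i = 0} \<times> {..<q}) \<subseteq> C"
        using add_closed smult_closed d(1) by auto
      show "C \<subseteq> ?f ` ({c \<in> C. c i = 0} \<times> {..<q})"
      proof
        fix e assume e: "e \<in> C"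
        \<comment> \<open>This is \<open>e - e i * d\<close>, with \<open>q - e i\<close> in place
          of a negative factor.\<close>
        let ?c = "\<lambda>j. (e j + ((q - e i) * d j) mod q) mod q"
        have le: "e i \<le> q" using bounded[OF e, of i] by simp
        have "?c \<in> C" using add_closed e smult_closed d(1) by auto
        moreover have "?c i = 0" using d(2) le by (simp add: mod_add_right_eq)
        moreover have "?f (?c, e i) j = e j" for j
        proof -
          have "?f (?c, e i) j = (e j + (q - e i) * d j + e i * d j) mod q"
            by (simp add: mod_simps)
          also have "\<dots> = (e j + q * d j) mod q"
            using le by (simp add: add.assoc flip: add_mult_distrib)
          finally show ?thesis using bounded[OF e, of j] by simp
        qed
        ultimately show "e \<in> ?f ` ({c \<in> C. c i = 0} \<times> {..<q})"
          using bounded[OF e, of i] by (intro image_eqI[of _ _ "(?c, e i)"]) auto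
      qed
    qed
  qed
  then have "card ({c \<in> C. c i = 0} \<times> {..<q}) = card C" by (rule bij_betw_same_card)
  then show ?thesis by (simp add: card_cartesian_product mult.commute)
qed

section \<open>Action on points and composition law\<close>

text \<open>The point \<open>(i, x)\<close> of \<open>{..<p} \<times> {..<q}\<close> is encoded as \<open>i * q + x\<close>.\<close>

definition act :: "(nat \<Rightarrow> nat) \<Rightarrow> nat \<Rightarrow> nat \<Rightarrow> nat" where
  "act c s n = (if n < p * q
     then ((n div q + s) mod p) * q + (n mod q + c (n div q)) mod q else n)"

definition code_group :: "(nat \<Rightarrow> nat) set" where
  "code_group = (\<lambda>(c, s). act c s) ` (C \<times> {..<p})"

lemma encode_less: "i < p \<Longrightarrow> x < q \<Longrightarrow> i * q + x < p * q"
proof -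
  assume "i < p" "x < q"
  then have "i * q + x < Suc i * q" by simp
  also have "\<dots> \<le> p * q" using \<open>i < p\<close> by (intro mult_le_mono) auto
  finally show ?thesis .
qed

lemma decode:
  assumes "n < p * q"
  obtains i x where "n = i * q + x" "i < p" "x < q"
proof
  show "n = (n div q) * q + n mod q" by simp
  show "n div q < p" using assms by (simp add: less_mult_imp_div_less)
  show "n mod q < q" using q_gt_1 by simp
qed

lemma act_encode:
  assumes "i < p" "x < q"
  shows "act c s (i * q + x) = ((i + s) mod p) * q + (x + c i) mod q"
  using encode_less[OF assms] assms by (simp add: act_def)

lemma encode_eq_iff:
  assumes "x < q" "y < q"
  shows "i * q + x = j * q + y \<longleftrightarrow> i = j \<and> x = y"
proof
  assume eq: "i * q + x = j * q + y"
  have "(i * q + x) div q = (j * q + y) div q" "(i * q + x) mod q = (j * q + y) mod q"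
    by (simp_all only: eq)
  then show "i = j \<and> x = y" using assms by simp
qed simp

text \<open>The second map acts in the fibre to which the first has moved the point, so its word
  enters shifted by \<open>s\<close>. This is the multiplication of a semidirect product of
  \<open>C\<close> with Z/p.\<close>

lemma act_comp:
  assumes "c \<in> C" "d \<in> C"
  shows "act d t \<circ> act c s = act (\<lambda>i. (c i + d (i + s)) mod q) ((s + t) mod p)"
proof
  fix n
  show "(act d t \<circ> act c s) n = act (\<lambda>i. (c i + d (i + s)) mod q) ((s + t) mod p) n"
  proof (cases "n < p * q")
    case True
    then obtain i x where n: "n = i * q + x" "i < p" "x < q" by (rule decode)
    have "act d t (act c s n) =
        (((i + s) mod p + t) mod p) * q + ((x + c i) mod q + d ((i + s) mod p)) mod q"
      using n p_gt_1 q_gt_1 by (simp add: act_encode)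
    also have "\<dots> = (i + (s + t)) mod p * q + (x + (c i + d (i + s))) mod q"
      by (simp add: periodic_mod[OF assms(2)] mod_simps add_ac)
    also have "\<dots> = act (\<lambda>i. (c i + d (i + s)) mod q) ((s + t) mod p) n"
      using n by (simp add: act_encode mod_simps)
    finally show ?thesis by simp
  qed (simp add: act_def)
qed

text \<open>The image of the point \<open>(i, 0)\<close> reveals both \<open>s\<close> and
  \<open>c i\<close>. Hence sets of group elements can be counted as sets of pairs.\<close>

lemma act_eq_iff:
  assumes "c \<in> C" "d \<in> C" "s < p" "t < p"
  shows "act c s = act d t \<longleftrightarrow> c = d \<and> s = t"
proof
  assume eq: "act c s = act d t"
  have *: "(i + s) mod p = (i + t) mod p \<and> c i = d i" if "i < p" for i
  proof -
    have "((i + s) mod p) * q + c i = ((i + t) mod p) * q + d i"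
      using fun_cong[OF eq, of "i * q + 0"] that q_gt_1 assms bounded
      by (simp add: act_encode[OF that, of 0, simplified])
    then show ?thesis using encode_eq_iff bounded assms by simp
  qed
  have "s = t" using *[of 0] assms p_gt_1 by simp
  moreover have "c = d" using * assms by (intro words_eqI) auto
  ultimately show "c = d \<and> s = t" by simp
qed simp

lemma inj_act: "inj_on (\<lambda>(c, s). act c s) (C \<times> {..<p})"
  by (auto intro!: inj_onI simp: act_eq_iff)

lemma act_in: "n < p * q \<Longrightarrow> act c s n < p * q"
  using p_gt_1 q_gt_1 by (auto simp: act_def intro!: encode_less)

lemma act_0: "c \<in> C \<Longrightarrow> (\<And>i. c i = 0) \<Longrightarrow> act c 0 = id"
  by (rule ext, case_tac "x < p * q")
    (auto simp: act_def less_mult_imp_div_less)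

lemma zero_word: "(\<lambda>i. 0) \<in> C"
  using nontrivial smult_closed[of _ 0] by auto

lemma act_left_inverse:
  assumes "c \<in> C" "s < p"
  obtains d t where "d \<in> C" "t < p" "act d t \<circ> act c s = id"
proof -
  \<comment> \<open>The factor \<open>q - 1\<close> is -1 modulo \<open>q\<close>, so
    \<open>e\<close> is the word \<open>-c\<close>.\<close>
  define e where "e = (\<lambda>i. ((q - 1) * c i) mod q)"
  have e: "e \<in> C" unfolding e_def by (rule smult_closed[OF assms(1)])
  \<comment> \<open>The offset \<open>p - s\<close> cancels the shift by \<open>s\<close>, as
    \<open>d (i + s) = e (i + p) = e i\<close>.\<close>
  define d where "d = (\<lambda>i. e (i + (p - s)))"
  have d: "d \<in> C" unfolding d_def by (rule shift_by_closed[OF e])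
  have "(c i + d (i + s)) mod q = 0" for i
  proof -
    have "d (i + s) = e i" unfolding d_def using periodic[OF e] assms by simp
    then have "(c i + d (i + s)) mod q = (c i + (q - 1) * c i) mod q"
      unfolding e_def by (simp add: mod_simps)
    also have "c i + (q - 1) * c i = q * c i" using q_gt_1 by (cases q) auto
    finally show ?thesis by simp
  qed
  \<comment> \<open>The inner reduction matters for \<open>s = 0\<close>, where \<open>p - s\<close>
    is out of range.\<close>
  moreover have "(s + (p - s) mod p) mod p = 0" using assms by (simp add: mod_simps)
  ultimately have "act d ((p - s) mod p) \<circ> act c s = act (\<lambda>i. 0) 0"
    by (simp add: act_comp[OF assms(1) d])
  also have "\<dots> = id" by (rule act_0[OF zero_word]) simp
  finally show thesis using that[OF d, of "(p - s) mod p"] p_gt_1 by simp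
qed

text \<open>A left inverse gives injectivity, and an injective map of a finite set into itself is
  onto.\<close>

lemma act_permutes:
  assumes "c \<in> C" "s < p"
  shows "act c s permutes {0..<p * q}"
proof (rule bij_imp_permutes)
  obtain d t where "act d t \<circ> act c s = id" using act_left_inverse[OF assms] .
  then have "inj (act c s)" by (metis inj_on_id inj_on_imageI2)
  then have "inj_on (act c s) {0..<p * q}" by (rule inj_on_subset) simp
  moreover have "act c s ` {0..<p * q} \<subseteq> {0..<p * q}" using act_in by auto
  ultimately show "bij_betw (act c s) {0..<p * q} {0..<p * q}"
    by (simp add: bij_betw_def endo_inj_surj)
qed (simp add: act_def)

section \<open>Group axioms, transitivity and blocks\<close>

lemma perm_group_code_group: "perm_group {0..<p * q} code_group"
  unfolding perm_group_def
proof (intro conjI ballI)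
  show "id \<in> code_group"
    using act_0[OF zero_word] zero_word p_gt_1
    by (auto simp: code_group_def intro!: image_eqI[of _ _ "(\<lambda>i. 0, 0)"])
next
  fix g assume "g \<in> code_group"
  then show "g permutes {0..<p * q}" by (auto simp: code_group_def act_permutes)
next
  fix g h assume "g \<in> code_group" "h \<in> code_group"
  then obtain c s d t where *: "g = act d t" "h = act c s" "c \<in> C" "d \<in> C" "s < p" "t < p"
    by (auto simp: code_group_def)
  have "(\<lambda>i. (c i + d (i + s)) mod q) \<in> C"
    using add_closed[OF *(3) shift_by_closed[OF *(4)]] .
  then show "g \<circ> h \<in> code_group"
    using * p_gt_1 by (force simp: act_comp code_group_def)
next
  fix g assume "g \<in> code_group"
  then obtain c s where *: "g = act c s" "c \<in> C" "s < p" by (auto simp: code_group_def)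
  obtain d t where dt: "d \<in> C" "t < p" "act d t \<circ> g = id" using act_left_inverse * by metis
  have "bij g" using act_permutes * permutes_bij by blast
  then have "inv_into UNIV g = act d t" using dt(3) by (metis bij_is_surj comp_id fun.map_comp id_comp surj_iff)
  then show "inv_into UNIV g \<in> code_group" using dt by (auto simp: code_group_def)
qed

lemma transitive_code_group: "transitive_group {0..<p * q} code_group"
  unfolding transitive_group_def
proof (intro ballI)
  fix u v assume "u \<in> {0..<p * q}" "v \<in> {0..<p * q}"
  then obtain i x j y where u: "u = i * q + x" "i < p" "x < q" and v: "v = j * q + y" "j < p" "y < q"
    by (metis atLeastLessThan_iff decode)
  \<comment> \<open>The entry \<open>y - x\<close> at \<open>i\<close> and the shift by
    \<open>j - i\<close> take \<open>(i, x)\<close> to \<open>(j, y)\<close>; adding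
    \<open>q\<close> and \<open>p\<close> avoids negative differences.\<close>
  obtain c where c: "c \<in> C" "c i = (y + (q - x)) mod q"
    using word_with_value[of "(y + (q - x)) mod q" i] q_gt_1 by auto
  have "act c ((j + (p - i)) mod p) u = v"
    using u v c(2) by (simp add: act_encode mod_simps)
  then show "\<exists>g\<in>code_group. g u = v"
    using c(1) p_gt_1 by (force simp: code_group_def)
qed

definition fibres :: "nat set set" where
  "fibres = (\<lambda>i. {i * q..<i * q + q}) ` {..<p}"

lemma fibre_eq: "{i * q..<i * q + q} = (\<lambda>x. i * q + x) ` {..<q}"
  by (simp add: lessThan_atLeast0 image_add_atLeastLessThan add.commute)

lemma block_system_fibres: "block_system {0..<p * q} code_group fibres"
  unfolding block_system_def
proof (intro conjI ballI impI)
  fix B assume "B \<in> fibres"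
  then show "B \<noteq> {}" using q_gt_1 by (auto simp: fibres_def)
next
  show "\<Union> fibres = {0..<p * q}"
  proof
    show "\<Union> fibres \<subseteq> {0..<p * q}"
      unfolding fibres_def fibre_eq using encode_less by auto
    show "{0..<p * q} \<subseteq> \<Union> fibres"
    proof
      fix n assume "n \<in> {0..<p * q}"
      then obtain i x where "n = i * q + x" "i < p" "x < q" by (metis atLeastLessThan_iff decode)
      then show "n \<in> \<Union> fibres" unfolding fibres_def fibre_eq by blast
    qed
  qed
next
  fix B D assume "B \<in> fibres" "D \<in> fibres" "B \<noteq> D"
  then show "B \<inter> D = {}" unfolding fibres_def fibre_eq using encode_eq_iff by auto
next
  fix g B assume "g \<in> code_group" "B \<in> fibres"
  then obtain c s i where *: "g = act c s" "c \<in> C" "s < p" "B = {i * q..<i * q + q}" "i < p"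
    by (auto simp: code_group_def fibres_def)
  define j where "j = (i + s) mod p"
  have j: "j < p" using p_gt_1 by (simp add: j_def)
  \<comment> \<open>Inclusion is enough, since both sets have \<open>q\<close> elements.\<close>
  have "g ` B \<subseteq> {j * q..<j * q + q}"
    unfolding *(4) fibre_eq using * q_gt_1 by (auto simp: act_encode j_def)
  moreover have "card (g ` B) = q"
  proof -
    have "inj_on g B" using act_permutes * by (meson inj_on_subset permutes_inj subset_UNIV)
    then show ?thesis using * by (simp add: card_image)
  qed
  ultimately have "g ` B = {j * q..<j * q + q}" by (intro card_subset_eq) auto
  then show "g ` B \<in> fibres" using j by (auto simp: fibres_def)
qed

lemma card_fibre: "B \<in> fibres \<Longrightarrow> card B = q"
  by (auto simp: fibres_def)

lemma imprimitive_code_group: "imprimitive_group {0..<p * q} code_group"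
proof -
  have "{0..<q} \<in> fibres"
    using p_gt_1 unfolding fibres_def by (intro image_eqI[of _ _ 0]) auto
  moreover have "card {0..<q} \<noteq> card {0..<p * q}" using p_gt_1 q_gt_1 by simp
  then have "{0..<q} \<noteq> {0..<p * q}" by metis
  ultimately show ?thesis
    unfolding imprimitive_group_def using block_system_fibres q_gt_1
    by (intro exI[of _ fibres] conjI bexI[of _ "{0..<q}"]) auto
qed

section \<open>Stabilizers, intersecting sets and density\<close>

lemma finite_code_group: "finite code_group"
  by (simp add: code_group_def finite_C)

text \<open>Fixing a point of fibre \<open>i\<close> forces the shift to be 0 and the word to vanish
  at \<open>i\<close>; \<open>card_vanishing\<close> counts these words.\<close>

lemma card_stabilizer:
  assumes "v < p * q"
  shows "q * card (stabilizer code_group v) = card C"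
proof -
  obtain i x where v: "v = i * q + x" "i < p" "x < q" using decode[OF assms] .
  have fixed: "act c s v = v \<longleftrightarrow> s = 0 \<and> c i = 0" if c: "c \<in> C" "s < p" for c s
  proof -
    have "act c s v = v \<longleftrightarrow> (i + s) mod p = i \<and> (x + c i) mod q = x"
      using v encode_eq_iff[of "(x + c i) mod q" x] by (simp add: act_encode)
    also have "(i + s) mod p = i \<longleftrightarrow> s = 0"
      using v(2) c(2) by (auto simp: mod_if split: if_splits)
    also have "(x + c i) mod q = x \<longleftrightarrow> c i = 0"
      using v(3) bounded[OF c(1), of i] by (auto simp: mod_if split: if_splits)
    finally show ?thesis .
  qed
  have "stabilizer code_group v = (\<lambda>(c, s). act c s) ` ({c \<in> C. c i = 0} \<times> {0})"
    using fixed p_gt_1 by (auto simp: stabilizer_def code_group_def)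
  also have "card \<dots> = card ({c \<in> C. c i = 0} \<times> {0::nat})"
    using p_gt_1 by (intro card_image inj_on_subset[OF inj_act]) auto
  finally show ?thesis using card_vanishing[of i] by (simp add: card_cartesian_product)
qed

text \<open>The difference of two words is again a word, written with \<open>q - 1\<close> for -1,
  and they agree at its zero.\<close>

lemma words_agree_somewhere:
  assumes "c \<in> C" "d \<in> C"
  shows "\<exists>i<p. c i = d i"
proof -
  have "(\<lambda>i. (c i + (q - 1) * d i mod q) mod q) \<in> C"
    using add_closed[OF assms(1) smult_closed[OF assms(2)]] .
  from has_zero[OF this] obtain i where "(c i + (q - 1) * d i mod q) mod q = 0" by (elim exE)
  then have "[c i + (q - 1) * d i = 0] (mod q)" by (simp add: cong_def mod_simps)
  then have "[c i + (q - 1) * d i + d i = d i] (mod q)"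
    using cong_add_rcancel_nat[of _ "d i" 0] by simp
  moreover have "c i + (q - 1) * d i + d i = c i + q * d i" using q_gt_1 by (cases q) auto
  ultimately have "[c i + q * d i = d i] (mod q)" by (simp only:)
  then have "c i = d i" using bounded assms by (simp add: cong_def)
  \<comment> \<open>The zero may lie anywhere; periodicity brings it below \<open>p\<close>.\<close>
  then show ?thesis
    using periodic_mod[OF assms(1), of i] periodic_mod[OF assms(2), of i] p_gt_1
    by (intro exI[of _ "i mod p"]) simp
qed

text \<open>On an intersecting set the projection to words is injective, which gives the upper
  bound. The elements without shift attain it, as any two words agree somewhere.\<close>

lemma Max_intersecting:
  "Max {card F | F. F \<subseteq> code_group \<and> intersecting_set {0..<p * q} F} = card C"
proof (rule Max_eqI)
  have "{card F | F. F \<subseteq> code_group \<and> intersecting_set {0..<p * q} F} \<subseteq> card ` Pow code_group"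
    by auto
  then show "finite {card F | F. F \<subseteq> code_group \<and> intersecting_set {0..<p * q} F}"
    using finite_code_group by (meson finite_Pow_iff finite_imageI finite_subset)
next
  fix n assume "n \<in> {card F | F. F \<subseteq> code_group \<and> intersecting_set {0..<p * q} F}"
  then obtain F where F: "n = card F" "F \<subseteq> code_group" "intersecting_set {0..<p * q} F" by auto
  \<comment> \<open>\<open>E\<close> is \<open>F\<close> pulled back to parameters, so that words
    and shifts can be compared.\<close>
  define E where "E = {(c, s). c \<in> C \<and> s < p \<and> act c s \<in> F}"
  have "F = (\<lambda>(c, s). act c s) ` E" using F(2) by (auto simp: E_def code_group_def)
  moreover have "inj_on (\<lambda>(c, s). act c s) E"
    by (rule inj_on_subset[OF inj_act]) (auto simp: E_def)
  ultimately have "card F = card E" by (simp add: card_image)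
  \<comment> \<open>Elements with the same word differ by a shift, which moves every fibre.\<close>
  moreover have "inj_on fst E"
  proof (rule inj_onI)
    fix g h assume gh: "g \<in> E" "h \<in> E" "fst g = fst h"
    obtain c s t where E: "(c, s) \<in> E" "(c, t) \<in> E" and g: "g = (c, s)" "h = (c, t)"
      using gh by (metis prod.collapse)
    have st: "s < p" "t < p" using E by (auto simp: E_def)
    have "\<exists>v\<in>{0..<p * q}. act c s v = act c t v"
      using F(3) E unfolding intersecting_set_def intersecting_pair_def E_def by auto
    then obtain v where v: "v < p * q" "act c s v = act c t v" by auto
    obtain i x where ix: "v = i * q + x" "i < p" "x < q" using decode[OF v(1)] .
    have "(i + s) mod p = (i + t) mod p"
      using v(2) ix q_gt_1 by (simp add: act_encode)
    then have "[i + s = i + t] (mod p)" by (simp add: cong_def)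
    then have "[s = t] (mod p)" by (simp only: cong_add_lcancel_nat)
    then show "g = h" using st g by (simp add: cong_def)
  qed
  then have "card E \<le> card C"
    by (rule card_inj_on_le) (auto simp: E_def finite_C)
  ultimately show "n \<le> card C" using F(1) by simp
next
  let ?F = "(\<lambda>(c, s). act c s) ` (C \<times> {0})"
  have "card ?F = card (C \<times> {0::nat})"
    using p_gt_1 by (intro card_image inj_on_subset[OF inj_act]) auto
  then have "card ?F = card C" by (simp add: card_cartesian_product)
  moreover have "?F \<subseteq> code_group" using p_gt_1 by (auto simp: code_group_def)
  moreover have "intersecting_pair {0..<p * q} (act c 0) (act d 0)" if cd: "c \<in> C" "d \<in> C" for c d
  proof -
    obtain i where i: "i < p" "c i = d i" using words_agree_somewhere[OF cd] by blast
    then have "act c 0 (i * q + 0) = act d 0 (i * q + 0)"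
      using q_gt_1 by (subst (1 2) act_encode) auto
    then show ?thesis
      unfolding intersecting_pair_def using encode_less[OF i(1), of 0] q_gt_1
      by (intro bexI[of _ "i * q + 0"]) auto
  qed
  then have "intersecting_set {0..<p * q} ?F" by (auto simp: intersecting_set_def)
  ultimately show "card C \<in> {card F | F. F \<subseteq> code_group \<and> intersecting_set {0..<p * q} F}"
    by (metis (mono_tags, lifting) mem_Collect_eq)
qed

text \<open>All stabilizers have order \<open>card C div q\<close>, so the denominator is the
  maximum of a one-element set.\<close>

lemma density_code_group: "intersection_density {0..<p * q} code_group = real q"
proof -
  have "card (stabilizer code_group v) = card C div q" if "v < p * q" for v
    using card_stabilizer[OF that] q_gt_1 by (metis nonzero_mult_div_cancel_left not_one_less_zero)
  then have "{card (stabilizer code_group v) | v. v \<in> {0..<p * q}} = {card C div q}"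
    using p_gt_1 q_gt_1 by (auto intro!: exI[of _ 0])
  moreover have "real (card C) = real q * real (card C div q)"
    using card_vanishing[of 0] by (metis dvd_triv_left dvd_mult_div_cancel of_nat_mult)
  moreover have "card C div q \<noteq> 0" using calculation(2) C_pos by (metis mult_zero_right of_nat_0 of_nat_eq_0_iff less_irrefl)
  ultimately show ?thesis by (simp add: intersection_density_def Max_intersecting)
qed

end

section \<open>Linear maps of prime order\<close>

text \<open>For \<open>2 \<le> k\<close> the hyperplane of vectors with zeroth coordinate 0 contains
  a nonzero vector.\<close>

locale prime_vectors =
  fixes q k :: nat
  assumes prime_q: "prime q" and k_ge_2: "2 \<le> k"
begin

text \<open>This is F_q^k with reduced residues, padded by zeros so that equality of vectors is
  equality of functions. Integer entries allow subtraction.\<close>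

definition vectors :: "(nat \<Rightarrow> int) set" where
  "vectors = {v. (\<forall>i. v i \<in> {0..<int q}) \<and> (\<forall>i\<ge>k. v i = 0)}"

text \<open>One operation covers sums (\<open>a = 1\<close>) and multiples
  (\<open>v = zero_vec\<close>), so a single equation expresses linearity.\<close>

definition comb :: "int \<Rightarrow> (nat \<Rightarrow> int) \<Rightarrow> (nat \<Rightarrow> int) \<Rightarrow> nat \<Rightarrow> int" where
  "comb a u v = (\<lambda>i. (a * u i + v i) mod int q)"

abbreviation zero_vec :: "nat \<Rightarrow> int" where
  "zero_vec \<equiv> \<lambda>_. 0"

abbreviation scale :: "int \<Rightarrow> (nat \<Rightarrow> int) \<Rightarrow> nat \<Rightarrow> int" where
  "scale a u \<equiv> comb a u zero_vec"

definition unit_vec :: "nat \<Rightarrow> nat \<Rightarrow> int" where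
  "unit_vec j = (\<lambda>i. if i = j then 1 else 0)"

text \<open>Through \<open>permutes\<close> the maps are the identity outside
  \<open>vectors\<close>, so that \<open>id\<close> and composition of functions are the group
  operations and \<open>GL\<close> is finite.\<close>

definition GL :: "((nat \<Rightarrow> int) \<Rightarrow> nat \<Rightarrow> int) set" where
  "GL = {A. A permutes vectors \<and>
     (\<forall>a. \<forall>u\<in>vectors. \<forall>v\<in>vectors. A (comb a u v) = comb a (A u) (A v))}"

section \<open>Arithmetic of vectors and the linear group\<close>

lemma q_gt_1: "1 < q"
  using prime_q prime_gt_1_nat by blast

lemma prime_int_q: "prime (int q)"
  using prime_q by simp

lemma zero_in: "zero_vec \<in> vectors"
  using q_gt_1 by (simp add: vectors_def)

lemma unit_in: "j < k \<Longrightarrow> unit_vec j \<in> vectors"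
  using q_gt_1 by (auto simp: vectors_def unit_vec_def)

lemma unit_ne_zero: "unit_vec j \<noteq> zero_vec"
  by (auto simp: unit_vec_def dest: fun_cong[of _ _ j])

lemma comb_in: "u \<in> vectors \<Longrightarrow> v \<in> vectors \<Longrightarrow> comb a u v \<in> vectors"
  using q_gt_1 by (auto simp: vectors_def comb_def)

lemma vectors_mod: "v \<in> vectors \<Longrightarrow> v i mod int q = v i"
  by (auto simp: vectors_def)

lemma vectors_eqI:
  assumes "u \<in> vectors" "v \<in> vectors" "\<And>i. [u i = v i] (mod int q)"
  shows "u = v"
  using assms vectors_mod unfolding cong_def by (metis ext)

lemma vectors_dvd: "v \<in> vectors \<Longrightarrow> int q dvd v i \<Longrightarrow> v i = 0"
  using vectors_mod by (metis dvd_imp_mod_0)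

lemma bij_restrict_vectors:
  "bij_betw (\<lambda>v. restrict v {..<k}) vectors ({..<k} \<rightarrow>\<^sub>E {0..<int q})"
proof (rule bij_betw_byWitness[where f' = "\<lambda>f i. if i < k then f i else 0"])
  show "\<forall>v\<in>vectors. (\<lambda>i. if i < k then restrict v {..<k} i else 0) = v"
    by (auto simp: vectors_def)
  show "\<forall>f\<in>{..<k} \<rightarrow>\<^sub>E {0..<int q}. restrict (\<lambda>i. if i < k then f i else 0) {..<k} = f"
    by (fastforce simp: restrict_def PiE_def extensional_def)
  show "(\<lambda>v. restrict v {..<k}) ` vectors \<subseteq> {..<k} \<rightarrow>\<^sub>E {0..<int q}"
    by (rule image_subsetI) (simp add: vectors_def PiE_iff)
  show "(\<lambda>f i. if i < k then f i else 0) ` ({..<k} \<rightarrow>\<^sub>E {0..<int q}) \<subseteq> vectors"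
    using q_gt_1 by (intro image_subsetI) (simp add: vectors_def PiE_iff)
qed

lemma finite_vectors: "finite vectors"
  using bij_betw_finite[OF bij_restrict_vectors] by (simp add: finite_PiE)

lemma card_vectors: "card vectors = q ^ k"
  using bij_betw_same_card[OF bij_restrict_vectors] by (simp add: card_PiE)

lemma scale_in: "u \<in> vectors \<Longrightarrow> scale a u \<in> vectors"
  by (simp add: comb_in zero_in)

lemma scale_scale: "scale a (scale b u) = scale (a * b) u"
  by (simp add: comb_def mod_simps mult.assoc)

lemma scale_cong: "[a = b] (mod int q) \<Longrightarrow> scale a u = scale b u"
  by (auto simp: comb_def cong_def intro!: ext mod_mult_cong)

lemma scale_1: "u \<in> vectors \<Longrightarrow> scale 1 u = u"
  by (auto simp: comb_def vectors_mod)

text \<open>Some coordinate of \<open>u\<close> is nonzero, hence a unit modulo the prime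
  \<open>q\<close>, and can be cancelled.\<close>

lemma scale_cancel:
  assumes "u \<in> vectors" "u \<noteq> zero_vec" "scale a u = scale b u"
  shows "[a = b] (mod int q)"
proof -
  obtain i where "u i \<noteq> 0" using assms(2) by auto
  then have "\<not> int q dvd u i" using vectors_dvd assms(1) by blast
  then have "coprime (u i) (int q)"
    using prime_int_q by (metis coprime_commute prime_imp_coprime)
  moreover have "[a * u i = b * u i] (mod int q)"
    using fun_cong[OF assms(3), of i] by (simp add: comb_def cong_def)
  ultimately show ?thesis by (simp add: cong_mult_rcancel)
qed

lemma GL_permutes: "A \<in> GL \<Longrightarrow> A permutes vectors"
  by (simp add: GL_def)

lemma GL_in: "A \<in> GL \<Longrightarrow> u \<in> vectors \<Longrightarrow> A u \<in> vectors"
  using GL_permutes permutes_in_image by fastforce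

lemma GL_comb:
  "A \<in> GL \<Longrightarrow> u \<in> vectors \<Longrightarrow> v \<in> vectors \<Longrightarrow> A (comb a u v) = comb a (A u) (A v)"
  by (simp add: GL_def)

lemma GL_inj: "A \<in> GL \<Longrightarrow> A u = A v \<longleftrightarrow> u = v"
  using GL_permutes permutes_inj by (metis injD)

lemma GL_zero:
  assumes "A \<in> GL" shows "A zero_vec = zero_vec"
proof -
  \<comment> \<open>\<open>comb (-1) x x\<close> is zero for every \<open>x\<close>, which evaluates
    both sides.\<close>
  have "A (comb (-1) zero_vec zero_vec) = comb (-1) (A zero_vec) (A zero_vec)"
    by (rule GL_comb[OF assms zero_in zero_in])
  then show ?thesis by (simp add: comb_def)
qed

lemma GL_scale: "A \<in> GL \<Longrightarrow> u \<in> vectors \<Longrightarrow> A (scale a u) = scale a (A u)"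
  by (simp add: GL_comb zero_in GL_zero)

lemma GL_nonzero: "A \<in> GL \<Longrightarrow> u \<noteq> zero_vec \<Longrightarrow> A u \<noteq> zero_vec"
  using GL_inj GL_zero by metis

lemma id_in_GL: "id \<in> GL"
  by (simp add: GL_def permutes_id)

lemma comp_in_GL:
  assumes "A \<in> GL" "B \<in> GL" shows "A \<circ> B \<in> GL"
proof -
  have "A \<circ> B permutes vectors" using assms GL_permutes permutes_compose by blast
  then show ?thesis using assms by (auto simp: GL_def[of] GL_comb GL_in)
qed

lemma inv_in_GL:
  assumes "A \<in> GL" shows "inv_into UNIV A \<in> GL"
proof -
  let ?B = "inv_into UNIV A"
  have perm: "?B permutes vectors" using GL_permutes[OF assms] by (rule permutes_inv)
  have AB: "A (?B u) = u" for u using GL_permutes[OF assms] by (simp add: permutes_inverses)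
  have "?B (comb a u v) = comb a (?B u) (?B v)" if uv: "u \<in> vectors" "v \<in> vectors" for a u v
  proof -
    have "?B u \<in> vectors" "?B v \<in> vectors" using perm uv by (simp_all add: permutes_in_image)
    then have "A (comb a (?B u) (?B v)) = A (?B (comb a u v))"
      using GL_comb[OF assms] AB by simp
    then show ?thesis using GL_inj[OF assms] by simp
  qed
  then show ?thesis using perm by (simp add: GL_def)
qed

lemma funpow_in_GL: "A \<in> GL \<Longrightarrow> A ^^ n \<in> GL"
  by (induction n) (auto intro: id_in_GL comp_in_GL simp: id_in_GL[unfolded id_def])

lemma finite_GL: "finite GL"
  by (rule finite_subset[OF _ finite_permutations[OF finite_vectors]]) (auto simp: GL_def)

section \<open>Transitivity on nonzero vectors and the order of GL(k, q)\<close>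

text \<open>A coordinate nonzero on both vectors works after scaling. Otherwise a coordinate nonzero
  on \<open>u\<close>, scaled, is added to one nonzero on \<open>w\<close>. The integer values
  matter only modulo \<open>q\<close>.\<close>

lemma separating_functional:
  assumes "u \<in> vectors" "w \<in> vectors" "u \<noteq> zero_vec" "w \<noteq> zero_vec"
  obtains f :: "(nat \<Rightarrow> int) \<Rightarrow> int"
    where "\<And>a x y. [f (comb a x y) = a * f x + f y] (mod int q)"
      and "[f u = 1] (mod int q)" and "\<not> int q dvd f w"
proof -
  have inverse: "\<exists>b. [u j * b = 1] (mod int q)" if "u j \<noteq> 0" for j
  proof -
    have "\<not> int q dvd u j" using that vectors_dvd assms(1) by blast
    then have "coprime (u j) (int q)"
      using prime_int_q by (metis coprime_commute prime_imp_coprime)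
    then show ?thesis by (rule cong_solve_coprime_int)
  qed
  have lin: "[a * ((c * x + y) mod int q) = c * (a * x) + a * y] (mod int q)" for a c x y
    by (simp add: cong_def mod_simps algebra_simps)
  have unit: "\<not> int q dvd b" if "[u j * b = 1] (mod int q)" for b j
  proof
    assume "int q dvd b"
    then have "int q dvd u j * b" by simp
    then have "int q dvd 1" using that by (simp only: cong_dvd_iff[OF that])
    then show False using prime_int_q not_prime_unit by blast
  qed
  show thesis
  proof (cases "\<exists>j. u j \<noteq> 0 \<and> w j \<noteq> 0")
    case True
    then obtain j b where j: "w j \<noteq> 0" "[u j * b = 1] (mod int q)" using inverse by blast
    then have "\<not> int q dvd b * w j"
      using unit vectors_dvd[OF assms(2)] prime_int_q by (metis prime_dvd_mult_iff)
    then show thesis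
      using j(2) lin by (intro that[of "\<lambda>x. b * x j"]) (auto simp: comb_def mult.commute)
  next
    case False
    obtain j l where jl: "u j \<noteq> 0" "w l \<noteq> 0" using assms(3,4) by (meson ext)
    \<comment> \<open>Each chosen coordinate vanishes on the other vector, so the two summands do
      not interfere.\<close>
    then have 0: "w j = 0" "u l = 0" using False by auto
    obtain b where b: "[u j * b = 1] (mod int q)" using inverse[OF jl(1)] by blast
    show thesis
    proof (rule that[of "\<lambda>x. b * x j + x l"])
      show "[b * comb a x y j + comb a x y l = a * (b * x j + x l) + (b * y j + y l)] (mod int q)"
        for a x y
      proof -
        have "[b * comb a x y j + comb a x y l = b * (a * x j + y j) + (a * x l + y l)] (mod int q)"
          by (intro cong_add cong_mult cong_refl) (simp_all add: comb_def cong_def)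
        then show ?thesis by (simp add: algebra_simps)
      qed
      show "[b * u j + u l = 1] (mod int q)" using b 0 by (simp add: mult.commute)
      show "\<not> int q dvd b * w j + w l" using 0 jl vectors_dvd[OF assms(2)] by auto
    qed
  qed
qed

text \<open>The map is \<open>x \<mapsto> x + f x \<cdot> (w - u)\<close>, which is invertible because \<open>1 + f (w - u) = f w \<noteq> 0\<close>.\<close>

lemma GL_transitive:
  assumes "u \<in> vectors" "w \<in> vectors" "u \<noteq> zero_vec" "w \<noteq> zero_vec"
  shows "\<exists>A\<in>GL. A u = w"
proof -
  obtain f :: "(nat \<Rightarrow> int) \<Rightarrow> int"
    where f: "\<And>a x y. [f (comb a x y) = a * f x + f y] (mod int q)"
      and fu: "[f u = 1] (mod int q)" and fw: "\<not> int q dvd f w"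
    using separating_functional[OF assms] by blast
  \<comment> \<open>\<open>d\<close> is left unreduced and may fall outside \<open>vectors\<close>;
    \<open>f\<close> is linear on all functions.\<close>
  define d where "d = (\<lambda>i. w i - u i)"
  define T where "T = (\<lambda>x. if x \<in> vectors then comb (f x) d x else x)"
  have T: "T x i = (f x * d i + x i) mod int q" if "x \<in> vectors" for x i
    using that by (simp add: T_def comb_def)
  have T_in: "T x \<in> vectors" if "x \<in> vectors" for x
    using that assms q_gt_1 by (auto simp: T_def vectors_def comb_def d_def)
  have fd: "[f d = f w - f u] (mod int q)"
  proof -
    have "[f (comb 1 d u) = f d + f u] (mod int q)" using f[of 1 d u] by simp
    moreover have "comb 1 d u = w"
      using vectors_mod[OF assms(2)] by (simp add: comb_def d_def)
    ultimately have "[f d + f u - f u = f w - f u] (mod int q)"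
      by (intro cong_diff cong_refl) (simp add: cong_sym_eq)
    then show ?thesis by simp
  qed
  \<comment> \<open>As \<open>f w\<close> is a unit, \<open>T x\<close> determines
    \<open>f x\<close>, and then \<open>x\<close> itself.\<close>
  have f_T: "[f (T x) = f x * f w] (mod int q)" if "x \<in> vectors" for x
  proof -
    have "[f (T x) = f x * f d + f x] (mod int q)" using f[of "f x" d x] that by (simp add: T_def)
    also have "[f x * f d + f x = f x * (f w - f u) + f x] (mod int q)"
      using fd by (intro cong_add cong_mult cong_refl)
    also have "[f x * (f w - f u) + f x = f x * (f w - 1) + f x] (mod int q)"
      using fu by (intro cong_add cong_mult cong_diff cong_refl)
    finally show ?thesis by (simp add: algebra_simps)
  qed
  have "inj_on T vectors"
  proof (rule inj_onI)
    fix x y assume xy: "x \<in> vectors" "y \<in> vectors" "T x = T y"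
    have "[f x * f w = f y * f w] (mod int q)"
      using f_T[OF xy(1)] f_T[OF xy(2)] xy(3) by (metis cong_sym cong_trans)
    moreover have "coprime (f w) (int q)"
      using fw prime_int_q by (metis coprime_commute prime_imp_coprime)
    ultimately have fxy: "[f x = f y] (mod int q)" by (simp add: cong_mult_rcancel)
    show "x = y"
    proof (rule vectors_eqI[OF xy(1,2)])
      fix i
      have "[f x * d i + x i = f y * d i + y i] (mod int q)"
        using fun_cong[OF xy(3), of i] T[OF xy(1)] T[OF xy(2)] by (simp add: cong_def)
      then have "[f x * d i + x i - f x * d i = f y * d i + y i - f y * d i] (mod int q)"
        using fxy by (intro cong_diff cong_mult cong_refl)
      then show "[x i = y i] (mod int q)" by simp
    qed
  qed
  moreover have "T ` vectors \<subseteq> vectors" using T_in by auto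
  ultimately have "bij_betw T vectors vectors"
    by (simp add: bij_betw_def endo_inj_surj finite_vectors)
  then have "T permutes vectors" by (rule bij_imp_permutes) (simp add: T_def)
  moreover have "T (comb a x y) = comb a (T x) (T y)"
    if xy: "x \<in> vectors" "y \<in> vectors" for a x y
  proof (rule vectors_eqI)
    fix i
    have "[T (comb a x y) i = f (comb a x y) * d i + comb a x y i] (mod int q)"
      using T[OF comb_in[OF xy]] by (simp add: cong_def)
    also have "[f (comb a x y) * d i + comb a x y i
        = (a * f x + f y) * d i + (a * x i + y i)] (mod int q)"
      by (intro cong_add cong_mult cong_refl f) (simp add: comb_def cong_def)
    also have "(a * f x + f y) * d i + (a * x i + y i)
        = a * (f x * d i + x i) + (f y * d i + y i)" by (simp add: algebra_simps)
    also have "[\<dots> = a * T x i + T y i] (mod int q)"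
      using T xy by (intro cong_add cong_mult cong_refl) (simp_all add: cong_def)
    also have "[a * T x i + T y i = comb a (T x) (T y) i] (mod int q)"
      by (simp add: comb_def cong_def)
    finally show "[T (comb a x y) i = comb a (T x) (T y) i] (mod int q)" .
  qed (use xy T_in comb_in in auto)
  ultimately have "T \<in> GL" by (simp add: GL_def)
  moreover have "T u = w"
  proof (rule vectors_eqI[OF T_in[OF assms(1)] assms(2)])
    fix i
    have "[T u i = f u * d i + u i] (mod int q)" using T[OF assms(1)] by (simp add: cong_def)
    also have "[f u * d i + u i = 1 * d i + u i] (mod int q)"
      using fu by (intro cong_add cong_mult cong_refl)
    finally show "[T u i = w i] (mod int q)" by (simp add: d_def)
  qed
  ultimately show ?thesis by blast
qed

text \<open>Orbit-stabilizer count: \<open>B w\<close> represents the coset of maps taking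
  \<open>unit_vec 0\<close> to \<open>w\<close>, and every element is uniquely such a representative
  composed with an element of the stabilizer \<open>S\<close>.\<close>

lemma card_GL_dvd: "(q ^ k - 1) dvd card GL"
proof -
  let ?e = "unit_vec 0" and ?X = "vectors - {zero_vec}"
  have e: "?e \<in> ?X" using unit_in[of 0] unit_ne_zero k_ge_2 by simp
  define S where "S = {A \<in> GL. A ?e = ?e}"
  obtain B where B: "\<And>w. w \<in> ?X \<Longrightarrow> B w \<in> GL \<and> B w ?e = w"
    using GL_transitive[of ?e] e by (metis DiffD1 DiffD2 insertI1)
  have "bij_betw (\<lambda>(A, w). B w \<circ> A) (S \<times> ?X) GL"
  proof (rule bij_betw_imageI)
    show "inj_on (\<lambda>(A, w). B w \<circ> A) (S \<times> ?X)"
    proof (rule inj_onI)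
      fix y z assume yz: "y \<in> S \<times> ?X" "z \<in> S \<times> ?X"
        "(case y of (A, w) \<Rightarrow> B w \<circ> A) = (case z of (A, w) \<Rightarrow> B w \<circ> A)"
      obtain A w A' w' where y: "y = (A, w)" and z: "z = (A', w')" by (cases y, cases z)
      have eq: "B w (A x) = B w' (A' x)" for x using yz(3) y z by (auto dest: fun_cong[of _ _ x])
      have "A ?e = ?e" "A' ?e = ?e" using yz y z by (auto simp: S_def)
      then have [simp]: "w' = w" using eq[of ?e] B yz y z by auto
      have "A x = A' x" for x using eq[of x] B[of w] GL_inj yz y by auto
      then show "y = z" using y z by auto
    qed
    show "(\<lambda>(A, w). B w \<circ> A) ` (S \<times> ?X) = GL"
    proof
      show "(\<lambda>(A, w). B w \<circ> A) ` (S \<times> ?X) \<subseteq> GL"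
        using B comp_in_GL by (auto simp: S_def)
      show "GL \<subseteq> (\<lambda>(A, w). B w \<circ> A) ` (S \<times> ?X)"
      proof
        fix A assume A: "A \<in> GL"
        define w where "w = A ?e"
        have w: "w \<in> ?X" using A e GL_in GL_nonzero by (auto simp: w_def)
        let ?I = "inv_into UNIV (B w)"
        have Bw: "B w permutes vectors" using B w GL_permutes by blast
        have "?I \<circ> A \<in> GL" using A B w inv_in_GL comp_in_GL by blast
        moreover have "(?I \<circ> A) ?e = ?e"
        proof -
          have "?I (B w ?e) = ?e" using Bw by (simp add: permutes_inverses)
          then show ?thesis using B[OF w] by (simp add: w_def)
        qed
        ultimately have "?I \<circ> A \<in> S" by (simp add: S_def)
        moreover have "A = B w \<circ> (?I \<circ> A)"
          using Bw by (simp add: fun_eq_iff permutes_inverses)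
        ultimately show "A \<in> (\<lambda>(A, w). B w \<circ> A) ` (S \<times> ?X)"
          using w by (intro image_eqI[of _ _ "(?I \<circ> A, w)"]) auto
      qed
    qed
  qed
  then have "card (S \<times> ?X) = card GL" by (rule bij_betw_same_card)
  moreover have "card ?X = q ^ k - 1" using zero_in card_vectors finite_vectors by simp
  ultimately show ?thesis by (metis card_cartesian_product dvd_triv_right)
qed

lemma group_GL: "group \<lparr>carrier = GL, mult = (\<circ>), one = id\<rparr>"
proof (rule groupI, goal_cases)
  \<comment> \<open>This case asks for a left inverse.\<close>
  case (5 A)
  then show ?case
    using inv_in_GL[of A] GL_permutes[of A]
    by (intro bexI[of _ "inv_into UNIV A"]) (auto simp: permutes_inv_o)
qed (auto simp: id_in_GL comp_in_GL)

text \<open>Cauchy's theorem by way of Sylow's: a subgroup of order \<open>p ^ 1\<close> has an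
  element other than \<open>id\<close>, and its elements have \<open>p\<close>-th power
  \<open>id\<close>.\<close>

lemma exists_GL_of_prime_order:
  assumes "prime p" "p dvd q ^ k - 1"
  shows "\<exists>A\<in>GL. A ^^ p = id \<and> A \<noteq> id"
proof -
  let ?G = "\<lparr>carrier = GL, mult = (\<circ>), one = id\<rparr>"
  obtain m where "order ?G = p ^ 1 * m"
    using dvd_trans[OF assms(2) card_GL_dvd] by (auto simp: order_def)
  then obtain H where H: "subgroup H ?G" "card H = p"
    using sylow_thm[OF assms(1) group_GL, of 1 m] finite_GL by auto
  interpret H: group "?G\<lparr>carrier := H\<rparr>" by (rule subgroup.subgroup_is_group[OF H(1) group_GL])
  have pow: "A [^]\<^bsub>?G\<lparr>carrier := H\<rparr>\<^esub> (n::nat) = A ^^ n" for A n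
    by (induction n) (simp_all add: funpow_Suc_right del: funpow.simps(2))
  have "\<not> H \<subseteq> {id}"
    using H(2) prime_gt_1_nat[OF assms(1)] card_mono[of "{id}" H] by auto
  then obtain A where A: "A \<in> H" "A \<noteq> id" by blast
  then have "A ^^ p = id" using H.pow_order_eq_1[of A] H(2) pow by (simp add: order_def)
  then show ?thesis using A subgroup.subset[OF H(1)] by auto
qed

end

text \<open>The condition on \<open>A\<close> makes the projective orbit of every vector moved by \<open>A\<close> regular, so that it
  exhausts the \<open>p\<close> points of projective space.\<close>

locale singer = prime_vectors +
  fixes p :: nat and A :: "(nat \<Rightarrow> int) \<Rightarrow> nat \<Rightarrow> int"
  assumes prime_p: "prime p" and p_count: "p * (q - 1) = q ^ k - 1" and p_gt: "q - 1 < p"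
    and A_GL: "A \<in> GL" and A_pow: "A ^^ p = id" and A_ne_id: "A \<noteq> id"
begin

section \<open>Projective orbits under \<open>A\<close>\<close>

lemma pow_in: "v \<in> vectors \<Longrightarrow> (A ^^ n) v \<in> vectors"
  using GL_in funpow_in_GL[OF A_GL] by blast

lemma pow_scale: "v \<in> vectors \<Longrightarrow> (A ^^ n) (scale a v) = scale a ((A ^^ n) v)"
  using GL_scale funpow_in_GL[OF A_GL] by blast

lemma pow_mult_p: "A ^^ (n * p) = id"
proof -
  have "A ^^ (p * n) = (A ^^ p) ^^ n" by (simp add: funpow_mult)
  then show ?thesis by (simp add: A_pow mult.commute id_funpow)
qed

lemma pow_fixes:
  assumes "(A ^^ m) v = v" shows "(A ^^ (m * n)) v = v"
proof (induction n)
  case (Suc n)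
  then show ?case using assms by (simp add: funpow_add)
qed simp

text \<open>If \<open>A ^^ d\<close> multiplied \<open>v\<close> by a unit, then
  \<open>A ^^ (d * (q - 1))\<close> would fix \<open>v\<close> by Fermat. That exponent is coprime
  to \<open>p\<close>, so \<open>A\<close> itself would fix \<open>v\<close>.\<close>

lemma not_eigenvector:
  assumes v: "v \<in> vectors" "A v \<noteq> v" and d: "0 < d" "d < p"
    and ab: "\<not> q dvd a" "\<not> q dvd b"
  shows "scale (int a) ((A ^^ d) v) \<noteq> scale (int b) v"
proof
  assume eq: "scale (int a) ((A ^^ d) v) = scale (int b) v"
  have "coprime a q" using ab prime_q by (metis coprime_commute prime_imp_coprime)
  then obtain c where c: "[a * c = 1] (mod q)"
    using cong_solve_coprime_nat by (metis One_nat_def)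
  \<comment> \<open>\<open>c\<close> inverts \<open>a\<close>, so \<open>e\<close> is the eigenvalue
    \<open>b / a\<close> of \<open>A ^^ d\<close>.\<close>
  define e where "e = c * b"
  have "\<not> q dvd c"
  proof
    assume "q dvd c"
    then have "q dvd 1" using cong_dvd_iff[OF c] by simp
    then show False using q_gt_1 by simp
  qed
  then have e: "\<not> q dvd e" using ab prime_q by (simp add: e_def prime_dvd_mult_iff)
  have "scale (int c) (scale (int a) ((A ^^ d) v)) = scale (int e) v"
    by (simp add: eq scale_scale e_def)
  moreover have "[int c * int a = 1] (mod int q)"
    using c by (metis cong_int_iff mult.commute of_nat_1 of_nat_mult)
  ultimately have step: "(A ^^ d) v = scale (int e) v"
    using scale_cong[of "int c * int a" 1] scale_1 pow_in[OF v(1)] by (simp add: scale_scale)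
  have "(A ^^ (d * n)) v = scale (int (e ^ n)) v" for n
  proof (induction n)
    case 0
    then show ?case using scale_1 v by simp
  next
    case (Suc n)
    have "(A ^^ (d * Suc n)) v = (A ^^ d) ((A ^^ (d * n)) v)" by (simp add: funpow_add)
    then show ?case using Suc step pow_scale[OF v(1)] by (simp add: scale_scale mult.commute)
  qed
  moreover have "[int (e ^ (q - 1)) = int 1] (mod int q)"
    using fermat_theorem[OF prime_q e] by (simp only: cong_int_iff)
  ultimately have *: "(A ^^ (d * (q - 1))) v = v"
    using scale_cong scale_1[OF v(1)] by (metis of_nat_1)
  \<comment> \<open>Both numbers are positive and smaller than \<open>p\<close>.\<close>
  have "\<not> p dvd d" "\<not> p dvd q - 1" using d p_gt q_gt_1 by (auto dest: dvd_imp_le)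
  then have "coprime p (d * (q - 1))"
    using prime_p by (simp add: prime_dvd_mult_iff prime_imp_coprime)
  then have "gcd (d * (q - 1)) p = 1" by (simp add: gcd.commute)
  moreover have "d * (q - 1) \<noteq> 0" using d q_gt_1 by simp
  ultimately obtain x y where xy: "d * (q - 1) * x = p * y + 1" using bezout_nat by metis
  \<comment> \<open>The exponent is 1 modulo \<open>p\<close> and a multiple of
    \<open>d * (q - 1)\<close>.\<close>
  have "A v = (A ^^ (y * p + 1)) v" by (simp add: pow_mult_p)
  also have "\<dots> = v" using pow_fixes[OF *, of x] xy by (simp add: mult.commute)
  finally show False using v(2) by simp
qed

definition moved :: "nat \<Rightarrow> int" where
  "moved = (SOME v. A v \<noteq> v)"

lemma moved: "A moved \<noteq> moved" "moved \<in> vectors" "moved \<noteq> zero_vec"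
proof -
  show *: "A moved \<noteq> moved" unfolding moved_def using A_ne_id by (intro someI_ex[of "\<lambda>v. A v \<noteq> v"]) auto
  then show "moved \<in> vectors" using GL_permutes[OF A_GL] by (auto simp: permutes_def)
  show "moved \<noteq> zero_vec" using * GL_zero[OF A_GL] by auto
qed

text \<open>Different \<open>i\<close> give different lines by \<open>not_eigenvector\<close>, and
  on one line different scalars give different vectors. So the image has \<open>p * (q - 1)\<close>
  elements, as many as there are nonzero vectors.\<close>

lemma nonzero_vectors:
  "(\<lambda>(i, a). scale (int a) ((A ^^ i) moved)) ` ({..<p} \<times> {1..<q}) = vectors - {zero_vec}"
proof (rule card_subset_eq)
  let ?f = "\<lambda>(i, a). scale (int a) ((A ^^ i) moved)"
  have same: "i = j" if "i < p" "j < p" "\<not> q dvd a" "\<not> q dvd b" "j \<le> i"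
    "scale (int a) ((A ^^ i) moved) = scale (int b) ((A ^^ j) moved)" for i j a b
  proof (rule ccontr)
    assume "i \<noteq> j"
    \<comment> \<open>Cancelling \<open>A ^^ j\<close> reduces the comparison to one with
      \<open>moved\<close> itself.\<close>
    have "A ^^ i = A ^^ j \<circ> A ^^ (i - j)" using that by (simp flip: funpow_add)
    then have "(A ^^ j) (scale (int a) ((A ^^ (i - j)) moved)) = (A ^^ j) (scale (int b) moved)"
      using that pow_scale moved pow_in by simp
    then have "scale (int a) ((A ^^ (i - j)) moved) = scale (int b) moved"
      using GL_inj[OF funpow_in_GL[OF A_GL]] by simp
    then show False
      using not_eigenvector[OF moved(2,1), of "i - j" a b] that \<open>i \<noteq> j\<close> by simp
  qed
  have "inj_on ?f ({..<p} \<times> {1..<q})"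
  proof (rule inj_onI)
    fix y z assume yz: "y \<in> {..<p} \<times> {1..<q}" "z \<in> {..<p} \<times> {1..<q}" "?f y = ?f z"
    obtain i a j b where y: "y = (i, a)" and z: "z = (j, b)" by (cases y, cases z)
    have nd: "\<not> q dvd a" "\<not> q dvd b" using yz y z by (auto dest: dvd_imp_le)
    have [simp]: "j = i"
    proof (cases "j \<le> i")
      case True
      then show ?thesis using same[of i j a b] nd yz y z by simp
    next
      case False
      then show ?thesis using same[of j i b a] nd yz y z by simp
    qed
    have "[int a = int b] (mod int q)"
      using yz y z pow_in moved GL_nonzero[OF funpow_in_GL[OF A_GL]]
      by (intro scale_cancel[of "(A ^^ i) moved"]) auto
    then have "a = b" using yz y z by (simp add: cong_int_iff cong_def)
    then show "y = z" using y z by simp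
  qed
  then show "card (?f ` ({..<p} \<times> {1..<q})) = card (vectors - {zero_vec})"
    using p_count zero_in card_vectors finite_vectors
    by (simp add: card_image card_cartesian_product)
  show "?f ` ({..<p} \<times> {1..<q}) \<subseteq> vectors - {zero_vec}"
  proof clarify
    fix i a assume a: "a \<in> {1..<q}"
    have "scale (int a) ((A ^^ i) moved) \<noteq> zero_vec"
    proof
      assume "scale (int a) ((A ^^ i) moved) = zero_vec"
      then have "scale (int a) ((A ^^ i) moved) = scale 0 ((A ^^ i) moved)"
        by (simp add: comb_def)
      then have "[int a = 0] (mod int q)"
        using pow_in moved GL_nonzero[OF funpow_in_GL[OF A_GL]]
        by (intro scale_cancel[of "(A ^^ i) moved"]) auto
      then show False using a by (auto simp: cong_0_iff dest: dvd_imp_le)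
    qed
    then show "scale (int a) ((A ^^ i) moved) \<in> vectors - {zero_vec}"
      using scale_in pow_in moved by simp
  qed
qed (simp add: finite_vectors)

text \<open>Both \<open>v\<close> and \<open>unit_vec 1\<close> are multiples of members of the
  orbit of \<open>moved\<close>, at exponents \<open>i\<close> and \<open>j\<close>. Advancing
  \<open>v\<close> from \<open>i\<close> to \<open>j\<close> puts it on the line of
  \<open>unit_vec 1\<close>, which lies in the hyperplane.\<close>

lemma orbit_meets_hyperplane:
  assumes "v \<in> vectors" shows "\<exists>i. (A ^^ i) v 0 = 0"
proof (cases "v = zero_vec")
  case True
  then show ?thesis by (intro exI[of _ 0]) simp
next
  case False
  then have "v \<in> (\<lambda>(i, a). scale (int a) ((A ^^ i) moved)) ` ({..<p} \<times> {1..<q})"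
    using assms nonzero_vectors by simp
  then obtain i a where v: "v = scale (int a) ((A ^^ i) moved)" "i < p" by auto
  have "unit_vec 1 \<in> (\<lambda>(i, a). scale (int a) ((A ^^ i) moved)) ` ({..<p} \<times> {1..<q})"
    using nonzero_vectors unit_in[of 1] unit_ne_zero k_ge_2 by simp
  then obtain j b where w: "unit_vec 1 = scale (int b) ((A ^^ j) moved)" "1 \<le> b" "b < q" by auto
  have "\<not> int q dvd int b" using w by (auto dest: dvd_imp_le)
  moreover have "int q dvd int b * (A ^^ j) moved 0"
    using fun_cong[OF w(1), of 0] by (simp add: comb_def unit_vec_def mod_0_imp_dvd)
  ultimately have dvd: "int q dvd (A ^^ j) moved 0"
    using prime_int_q prime_dvd_mult_iff by blast
  \<comment> \<open>Since \<open>A\<close> has period \<open>p\<close>, the exponent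
    \<open>p - i\<close> acts as \<open>-i\<close>.\<close>
  have "(A ^^ (j + (p - i))) v = scale (int a) ((A ^^ (j + (p - i))) ((A ^^ i) moved))"
    unfolding v(1) by (rule pow_scale[OF pow_in[OF moved(2)]])
  also have "(A ^^ (j + (p - i))) ((A ^^ i) moved) = (A ^^ (j + p)) moved"
    using v(2) by (simp flip: funpow_add comp_apply[of "A ^^ _" "A ^^ _"])
  also have "\<dots> = (A ^^ j) moved" by (simp add: funpow_add A_pow)
  finally have "(A ^^ (j + (p - i))) v 0 = 0" using dvd by (simp add: comb_def)
  then show ?thesis by blast
qed

section \<open>The cyclic code of \<open>A\<close>\<close>

definition code :: "(nat \<Rightarrow> nat) set" where
  "code = (\<lambda>v i. nat ((A ^^ i) v 0)) ` vectors"

text \<open>Sums come from linearity of the powers of \<open>A\<close>, the shift from applying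
  \<open>A\<close> to the vector, the period from \<open>A_pow\<close>, and zeros from
  \<open>orbit_meets_hyperplane\<close>.\<close>

lemma cyclic_code_code: "cyclic_code p q code"
proof
  show "1 < p" using prime_p prime_gt_1_nat by blast
  show "prime q" by (rule prime_q)
next
  fix c assume "c \<in> code"
  then obtain v where v: "v \<in> vectors" "c = (\<lambda>i. nat ((A ^^ i) v 0))" by (auto simp: code_def)
  show "c (i + p) = c i" for i by (simp add: v(2) funpow_add A_pow)
  show "c i < q" for i
    using pow_in[OF v(1), of i] q_gt_1 by (simp add: v(2) vectors_def nat_less_iff)
  show "(\<lambda>i. c (Suc i)) \<in> code"
    unfolding code_def
  proof (rule image_eqI)
    show "A v \<in> vectors" using GL_in A_GL v(1) .
    show "(\<lambda>i. c (Suc i)) = (\<lambda>i. nat ((A ^^ i) (A v) 0))"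
      by (simp add: v(2) funpow_swap1)
  qed
  show "\<exists>i. c i = 0" using orbit_meets_hyperplane[OF v(1)] v(2) by (metis nat_0)
next
  fix c d assume "c \<in> code" "d \<in> code"
  then obtain u v where uv: "u \<in> vectors" "v \<in> vectors"
    and c: "c = (\<lambda>i. nat ((A ^^ i) u 0))" and d: "d = (\<lambda>i. nat ((A ^^ i) v 0))"
    by (auto simp: code_def)
  have "(c i + d i) mod q = nat ((A ^^ i) (comb 1 u v) 0)" for i
  proof -
    have "(A ^^ i) (comb 1 u v) = comb 1 ((A ^^ i) u) ((A ^^ i) v)"
      by (rule GL_comb[OF funpow_in_GL[OF A_GL] uv])
    then have "(A ^^ i) (comb 1 u v) 0 = ((A ^^ i) u 0 + (A ^^ i) v 0) mod int q"
      by (simp only: comb_def[of _ "(A ^^ i) u"] mult_1)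
    moreover have "0 \<le> (A ^^ i) u 0" "0 \<le> (A ^^ i) v 0"
      using pow_in uv by (auto simp: vectors_def)
    ultimately show ?thesis by (simp add: c d nat_mod_distrib nat_add_distrib)
  qed
  then show "(\<lambda>i. (c i + d i) mod q) \<in> code"
    using comb_in[OF uv] by (auto simp: code_def)
next
  \<comment> \<open>The word of \<open>unit_vec 0\<close> has entry 1 at position 0.\<close>
  have "(\<lambda>i. nat ((A ^^ i) (unit_vec 0) 0)) \<in> code"
    using unit_in[of 0] k_ge_2 by (simp add: code_def)
  then show "\<exists>c\<in>code. \<exists>i. c i \<noteq> 0"
    by (rule bexI[rotated]) (auto intro!: exI[of _ 0] simp: unit_vec_def)
qed

end

section \<open>Numerical conditions and conclusion\<close>

theorem theorem1p2:
  fixes p q k :: nat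
  assumes "prime p" "odd p" "prime q" "odd q" "k > 0"
    and "p = (q ^ k - 1) div (q - 1)"
  shows "\<exists>G :: (nat \<Rightarrow> nat) set.
           perm_group {0..<p * q} G \<and> transitive_group {0..<p * q} G \<and>
           imprimitive_group {0..<p * q} G \<and>
           (\<exists>\<B>. block_system {0..<p * q} G \<B> \<and> (\<forall>B\<in>\<B>. card B = q)) \<and>
           intersection_density {0..<p * q} G = real q"
proof -
  have q: "1 < q" using assms(3) prime_gt_1_nat by blast
  \<comment> \<open>For \<open>k = 1\<close> the quotient \<open>p\<close> would be 1.\<close>
  have "k \<noteq> 1" using assms(1,6) q by auto
  then have k: "2 \<le> k" using assms(5) by simp
  \<comment> \<open>Powers of \<open>q\<close> are 1 modulo \<open>q - 1\<close>, so the division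
    defining \<open>p\<close> is exact.\<close>
  have "[q = 1] (mod q - 1)" using q by (simp add: cong_altdef_nat)
  then have "[q ^ k = 1] (mod q - 1)" using cong_pow by fastforce
  then have "q - 1 dvd q ^ k - 1" by (rule cong_to_1_nat)
  then have count: "p * (q - 1) = q ^ k - 1" using assms(6) by simp
  \<comment> \<open>Comparison with exponent 2 gives \<open>q + 1 \<le> p\<close>, so that
    \<open>p\<close> cannot divide \<open>q - 1\<close>.\<close>
  have "q ^ 2 \<le> q ^ k" using k q by (intro power_increasing) auto
  moreover have "(q + 1) * (q - 1) = q ^ 2 - 1"
    using q by (simp add: power2_eq_square algebra_simps)
  ultimately have "(q + 1) * (q - 1) \<le> p * (q - 1)" using count by simp
  then have "q + 1 \<le> p" using q by (simp only: mult_le_cancel2)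
  then have p_gt: "q - 1 < p" by simp
  interpret prime_vectors q k using assms(3) k by unfold_locales
  have "p dvd q ^ k - 1" using count by (metis dvd_triv_left)
  then obtain A where A: "A \<in> GL" "A ^^ p = id" "A \<noteq> id"
    using exists_GL_of_prime_order assms(1) by blast
  interpret singer q k p A using A assms(1) count p_gt by unfold_locales
  interpret cyclic_code p q code by (rule cyclic_code_code)
  show ?thesis
    using card_fibre
    by (intro exI[of _ code_group] exI[of _ fibres] conjI ballI perm_group_code_group
        transitive_code_group imprimitive_code_group block_system_fibres density_code_group)
qed

end
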